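(* Let $G_s=(V,E,W)$ be a signed network whose underlying graph $G=(V,E)$ is connected, with $n$ nodes and $m$ edges. Let $\mathbf{H}$ be any fundamental cycle matrix for the graph $G$ and let $\mathbf{w}$ be the weight vector of $G_s$. Then $G_s$ is structurally balanced if and only if $$\mathbf{H}\cdot \mathbf{w}^T=\mathbf{0}_{m-n+1},$$ where the matrix product is taken in $\mathrm{GF}(2)$ and $\mathbf{0}_{m-n+1}$ is the column vector of dimension $m-n+1$ with all elements equal to $0$.
   Context: A signed network $G_s=(V,E,W)$ consists of a finite simple undirected graph $G=(V,E)$ together with a function $W:E\to\{+,-\}$; an edge with sign $+$ is positive and an edge with sign $-$ is negative. It is structurally balanced if every cycle of $G$ contains an even number of negative edges. Index the edges of $G$ by $1,2,\ldots,m$. Every (simple) cycle of $G$ is represented by the binary vector $\mathbf{h}=(h_1,\ldots,h_m)\in \mathrm{GF}(2)^m$ with $h_j=1$ if the $j$-th edge is in the cycle and $h_j=0$ otherwise. For a connected graph with $n$ nodes and $m$ edges, the maximum number of cycles that are linearly independent over $\mathrm{GF}(2)$ is $m-n+1$. A cycle basis is a collection of $m-n+1$ cycles whose vectors $\mathbf{h}_i=(h_{i,1},\ldots,h_{i,m})$, $i=1,\ldots,m-n+1$, are linearly independent over $\mathrm{GF}(2)$. The $(m-n+1)\times m$ matrix $\mathbf{H}=(h_{i,j})$ formed from any cycle basis is called a fundamental cycle matrix for $G$. The weight vector of $G_s$ is the row vector $\mathbf{w}=(w_1,\ldots,w_m)\in\mathrm{GF}(2)^m$ with $w_j=0$ if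 the $j$-th edge is positive and $w_j=1$ if the $j$-th edge is negative. *)

theory Defs
  imports "HOL-Library.Z2" "Jordan_Normal_Form.VS_Connect"
begin

text \<open>An edge is the set of its two end nodes, so there are no loops and no multiple edges.\<close>

definition simple_graph :: "'a set \<Rightarrow> 'a set set \<Rightarrow> bool" where
  "simple_graph V E \<longleftrightarrow> finite V \<and> (\<forall>e\<in>E. e \<subseteq> V \<and> card e = 2)"

definition connected_graph :: "'a set \<Rightarrow> 'a set set \<Rightarrow> bool" where
  "connected_graph V E \<longleftrightarrow>
     simple_graph V E \<and> V \<noteq> {} \<and> (\<forall>u\<in>V. \<forall>v\<in>V. (u, v) \<in> {(x, y). {x, y} \<in> E}\<^sup>*)"

definition closed_walk_edges :: "'a list \<Rightarrow> 'a set set" where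
  "closed_walk_edges p = {{p ! i, p ! (Suc i mod length p)} |i. i < length p}"

text \<open>A simple cycle is identified with its edge set; the bound on the length of the node sequence
  excludes walking back and forth along a single edge.\<close>

definition is_cycle :: "'a set set \<Rightarrow> 'a set set \<Rightarrow> bool" where
  "is_cycle E C \<longleftrightarrow>
     (\<exists>p. 3 \<le> length p \<and> distinct p \<and> C = closed_walk_edges p \<and> C \<subseteq> E)"

datatype sign = Pos | Neg

definition structurally_balanced :: "'a set set \<Rightarrow> ('a set \<Rightarrow> sign) \<Rightarrow> bool" where
  "structurally_balanced E W \<longleftrightarrow> (\<forall>C. is_cycle E C \<longrightarrow> even (card {e \<in> C. W e = Neg}))"

text \<open>An indexing of the edges is a duplicate-free list of them, with positions counted from 0.
  The type \<^typ>\<open>bit\<close> is the field GF(2).\<close>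

definition edge_indexing :: "'a set set \<Rightarrow> 'a set list \<Rightarrow> bool" where
  "edge_indexing E es \<longleftrightarrow> distinct es \<and> set es = E"

definition cycle_vector :: "'a set list \<Rightarrow> 'a set set \<Rightarrow> bit vec" where
  "cycle_vector es C = vec (length es) (\<lambda>j. if es ! j \<in> C then 1 else 0)"

definition weight_vector :: "'a set list \<Rightarrow> ('a set \<Rightarrow> sign) \<Rightarrow> bit vec" where
  "weight_vector es W = vec (length es) (\<lambda>j. case W (es ! j) of Pos \<Rightarrow> 0 | Neg \<Rightarrow> 1)"

text \<open>Linear dependence in the library is a property of sets of vectors, so repeated members of a
  family have to be excluded separately.\<close>

definition lin_indpt_list :: "nat \<Rightarrow> bit vec list \<Rightarrow> bool" where
  "lin_indpt_list m vs \<longleftrightarrow>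
     distinct vs \<and> \<not> module.lin_dep class_ring (module_vec TYPE(bit) m) (set vs)"

text \<open>The number of cycles is written \<open>m + 1 - n\<close> because subtraction on natural numbers
  truncates: for a tree, \<open>m - n + 1\<close> would be 1 instead of 0.\<close>

definition cycle_basis :: "'a set \<Rightarrow> 'a set set \<Rightarrow> 'a set list \<Rightarrow> 'a set set list \<Rightarrow> bool" where
  "cycle_basis V E es Cs \<longleftrightarrow>
     length Cs = card E + 1 - card V \<and>
     (\<forall>C\<in>set Cs. is_cycle E C) \<and>
     lin_indpt_list (card E) (map (cycle_vector es) Cs)"

definition fundamental_cycle_matrix ::
  "'a set \<Rightarrow> 'a set set \<Rightarrow> 'a set list \<Rightarrow> bit mat \<Rightarrow> bool" where
  "fundamental_cycle_matrix V E es H \<longleftrightarrow>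
     (\<exists>Cs. cycle_basis V E es Cs \<and> H = mat_of_rows (card E) (map (cycle_vector es) Cs))"

end

theory Submission
  imports Defs
begin

text \<open>A set of edges is a chain over GF(2), with addition given by symmetric difference. By
  connectivity the boundary map reaches every even set of vertices, so its kernel has at most
  \<open>2\<^sup>m\<^sup>-\<^sup>n\<^sup>+\<^sup>1\<close> elements. The kernel contains all cycles, and independence gives a cycle basis
  \<open>2\<^sup>m\<^sup>-\<^sup>n\<^sup>+\<^sup>1\<close> distinct subset sums; hence every cycle is a sum of basis cycles. The parity of the
  number of negative edges is additive.\<close>

section \<open>Sums modulo 2 of families of sets\<close>

text \<open>Elements of \<open>A \<inter> B\<close> are counted twice and cancel modulo 2. This one
  fact gives additivity of \<open>mod2_sum\<close>, of \<open>boundary\<close> and of the parity of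
  negative edges.\<close>

lemma odd_card_symdiff:
  assumes "finite A" "finite B"
  shows "odd (card {e \<in> sym_diff A B. P e}) \<longleftrightarrow>
    (odd (card {e \<in> A. P e}) \<noteq> odd (card {e \<in> B. P e}))"
proof -
  let ?X = "{e \<in> A - B. P e}" and ?Y = "{e \<in> B - A. P e}" and ?Z = "{e \<in> A \<inter> B. P e}"
  have fin: "finite ?X" "finite ?Y" "finite ?Z"
    using assms by auto
  have "{e \<in> sym_diff A B. P e} = ?X \<union> ?Y" "{e \<in> A. P e} = ?X \<union> ?Z" "{e \<in> B. P e} = ?Y \<union> ?Z"
    by blast+
  moreover have "card (?X \<union> ?Y) = card ?X + card ?Y" "card (?X \<union> ?Z) = card ?X + card ?Z"
    "card (?Y \<union> ?Z) = card ?Y + card ?Z"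
    by (rule card_Un_disjoint; use fin in blast)+
  ultimately show ?thesis by presburger
qed

text \<open>The GF(2) sum of the members of \<open>F\<close>: with coefficients 0 and 1 only, a
  linear combination is the choice of a subfamily.\<close>

definition mod2_sum :: "'b set set \<Rightarrow> 'b set" where
  "mod2_sum F = {e. odd (card {C \<in> F. e \<in> C})}"

lemma mod2_sum_symdiff:
  assumes "finite F" "finite G"
  shows "mod2_sum (sym_diff F G) = sym_diff (mod2_sum F) (mod2_sum G)"
  using odd_card_symdiff[OF assms] by (auto simp: mod2_sum_def)

lemma mod2_sum_singleton: "mod2_sum {C} = C"
proof -
  have "{D \<in> {C}. e \<in> D} = (if e \<in> C then {C} else {})" for e by auto
  then show ?thesis by (auto simp: mod2_sum_def)
qed

lemma mod2_sum_insert: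
  assumes "finite F" "C \<notin> F"
  shows "mod2_sum (insert C F) = sym_diff C (mod2_sum F)"
proof -
  have "insert C F = sym_diff {C} F" using assms(2) by auto
  then show ?thesis
    using mod2_sum_symdiff[of "{C}" F] assms(1) by (simp add: mod2_sum_singleton)
qed

text \<open>Transfers a property from cycles to their sums; it serves both for membership in the
  cycle space and for an even number of negative edges.\<close>

lemma mod2_sum_induct:
  assumes "finite F" "\<And>C. C \<in> F \<Longrightarrow> Q C" "Q {}"
    and "\<And>A B. Q A \<Longrightarrow> Q B \<Longrightarrow> Q (sym_diff A B)"
  shows "Q (mod2_sum F)"
  using assms(1,2)
proof (induction F)
  case empty
  then show ?case using assms(3) by (simp add: mod2_sum_def)
next
  case (insert C F)
  then show ?case using assms(4) by (simp add: mod2_sum_insert)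
qed

section \<open>The boundary map modulo 2\<close>

text \<open>The boundary of a 1-chain over GF(2): the nodes of odd degree in
  \<open>x\<close>.\<close>

definition boundary :: "'a set set \<Rightarrow> 'a set" where
  "boundary x = {v. odd (card {e \<in> x. v \<in> e})}"

lemma boundary_symdiff:
  assumes "finite x" "finite y"
  shows "boundary (sym_diff x y) = sym_diff (boundary x) (boundary y)"
  using odd_card_symdiff[OF assms] by (auto simp: boundary_def)

lemma boundary_empty: "boundary {} = {}"
  by (simp add: boundary_def)

lemma boundary_singleton: "boundary {e} = e"
proof -
  have "{d \<in> {e}. v \<in> d} = (if v \<in> e then {e} else {})" for v by auto
  then show ?thesis by (auto simp: boundary_def)
qed

lemma Suc_mod_eq: "i < l \<Longrightarrow> Suc i mod l = (if Suc i = l then 0 else Suc i)"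
  by auto

text \<open>Each node of the cycle is once the first and once the second end of an edge. The cyclic
  shift \<open>s\<close> of positions is a permutation, so both kinds of incidence are equally
  numerous.\<close>

lemma boundary_cycle:
  assumes "is_cycle E C"
  shows "boundary C = {}"
proof -
  obtain p where p: "3 \<le> length p" "distinct p" "C = closed_walk_edges p"
    using assms by (auto simp: is_cycle_def)
  define l where "l = length p"
  define s where "s i = Suc i mod l" for i
  define f where "f i = {p ! i, p ! s i}" for i
  have l3: "3 \<le> l" using p by (simp add: l_def)
  have s_lt: "s i < l" for i using l3 by (simp add: s_def)
  have s_neq: "s i \<noteq> i" if "i < l" for i
    using that l3 by (auto simp: s_def Suc_mod_eq)
  have nth_eq: "p ! i = p ! j \<longleftrightarrow> i = j" if "i < l" "j < l" for i j
    using that p(2) by (simp add: l_def nth_eq_iff_index_eq)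
  have inj_s: "inj_on s {..<l}"
    by (rule inj_onI) (auto simp: s_def Suc_mod_eq split: if_splits)
  have bij_s: "s ` {..<l} = {..<l}"
    by (rule endo_inj_surj) (use inj_s s_lt in auto)
  have C: "C = f ` {..<l}"
    using p(3) by (auto simp: closed_walk_edges_def f_def s_def l_def)
  have inj_f: "inj_on f {..<l}"
  proof (rule inj_onI)
    fix i j assume ij: "i \<in> {..<l}" "j \<in> {..<l}" "f i = f j"
    \<comment> \<open>The second alternative would make \<open>s\<close> return to \<open>j\<close>
      after two steps, which length at least 3 excludes.\<close>
    then have "i = j \<or> (i = s j \<and> s i = j)"
      using s_lt by (auto simp: f_def doubleton_eq_iff nth_eq)
    then show "i = j"
      using ij l3 by (auto simp: s_def Suc_mod_eq split: if_splits)
  qed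
  have "even (card {e \<in> C. v \<in> e})" for v
  proof -
    let ?A = "{i \<in> {..<l}. p ! i = v}" and ?B = "{i \<in> {..<l}. p ! s i = v}"
    have "{e \<in> C. v \<in> e} = f ` (?A \<union> ?B)"
      by (auto simp: C f_def)
    moreover have "inj_on f (?A \<union> ?B)"
      by (rule inj_on_subset[OF inj_f]) auto
    ultimately have "card {e \<in> C. v \<in> e} = card (?A \<union> ?B)"
      by (simp add: card_image)
    also have "\<dots> = card ?A + card ?B"
    proof (rule card_Un_disjoint)
      show "?A \<inter> ?B = {}" using s_neq s_lt nth_eq by fastforce
    qed auto
    also have "card ?B = card (s ` ?B)"
      by (rule card_image[symmetric], rule inj_on_subset[OF inj_s]) auto
    also have "s ` ?B = {j \<in> s ` {..<l}. p ! j = v}"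
      by blast
    also have "\<dots> = ?A"
      by (simp only: bij_s)
    finally show ?thesis by simp
  qed
  then show ?thesis by (simp add: boundary_def)
qed

text \<open>Adding the edges of a walk modulo 2 cancels its inner nodes. The form
  \<open>sym_diff {u} {v}\<close> also covers closed walks, where the boundary is empty.\<close>

lemma path_with_boundary:
  assumes "(u, v) \<in> {(x, y). {x, y} \<in> E}\<^sup>*"
  shows "\<exists>x. x \<subseteq> E \<and> finite x \<and> boundary x = sym_diff {u} {v}"
  using assms
proof (induction rule: rtrancl_induct)
  case base
  show ?case by (rule exI[of _ "{}"]) (simp add: boundary_empty)
next
  case (step v w)
  then obtain x where x: "x \<subseteq> E" "finite x" "boundary x = sym_diff {u} {v}" by blast
  show ?case
  \<comment> \<open>For \<open>v = w\<close> the set \<open>{v, w}\<close> is a singleton with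
    nonempty boundary, so it is not added; \<open>x\<close> already serves.\<close>
  proof (cases "v = w")
    case False
    have "boundary (sym_diff x {{v, w}}) = sym_diff {u} {w}"
      using x False by (subst boundary_symdiff) (auto simp: boundary_singleton)
    then show ?thesis
      using x step.hyps by (intro exI[of _ "sym_diff x {{v, w}}"]) auto
  qed (use x in blast)
qed

text \<open>Nodes enter \<open>S\<close> one at a time: adding a path from \<open>v\<close> to
  \<open>r\<close> changes the boundary only at \<open>v\<close> and at the disregarded node
  \<open>r\<close>.\<close>

lemma boundary_onto:
  assumes "connected_graph V E" "r \<in> V" "finite S" "S \<subseteq> V - {r}"
  shows "\<exists>x. x \<subseteq> E \<and> finite x \<and> boundary x - {r} = S"
  using assms(3,4)
proof (induction S)
  case empty
  show ?case by (rule exI[of _ "{}"]) (simp add: boundary_empty)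
next
  case (insert v S)
  then obtain x where x: "x \<subseteq> E" "finite x" "boundary x - {r} = S" by auto
  have vr: "(v, r) \<in> {(x, y). {x, y} \<in> E}\<^sup>*"
    using assms insert.prems by (auto simp: connected_graph_def)
  obtain y where y: "y \<subseteq> E" "finite y" "boundary y = sym_diff {v} {r}"
    using path_with_boundary[OF vr] by (elim exE conjE)
  have "v \<noteq> r" using insert.prems by simp
  moreover have "v \<notin> boundary x - {r}"
    unfolding x(3) by (rule insert.hyps(2))
  ultimately have "v \<noteq> r" "v \<notin> boundary x"
    by simp_all
  then have "boundary (sym_diff x y) - {r} = insert v (boundary x - {r})"
    unfolding boundary_symdiff[OF x(2) y(2)] y(3) by blast
  then have "boundary (sym_diff x y) - {r} = insert v S"
    by (simp only: x(3))
  moreover have "sym_diff x y \<subseteq> E" "finite (sym_diff x y)"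
    using x y by auto
  ultimately show ?case by blast
qed

section \<open>The size of the cycle space\<close>

definition cycle_space :: "'a set set \<Rightarrow> 'a set set set" where
  "cycle_space E = {x. x \<subseteq> E \<and> boundary x = {}}"

lemma finite_edges: "simple_graph V E \<Longrightarrow> finite E"
  by (rule finite_subset[of _ "Pow V"]) (auto simp: simple_graph_def)

text \<open>Forgetting one vertex \<open>r\<close> makes the boundary map surjective onto the subsets of
  \<open>V - {r}\<close>; all its fibres are translates of the fibre over the empty set, which contains the
  cycle space.\<close>

lemma card_cycle_space_le:
  assumes "connected_graph V E"
  shows "card (cycle_space E) \<le> 2 ^ (card E + 1 - card V)"
proof -
  have sg: "simple_graph V E" and "V \<noteq> {}"
    using assms by (auto simp: connected_graph_def)
  then have finV: "finite V" and finE: "finite E"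
    using finite_edges by (auto simp: simple_graph_def)
  obtain r where r: "r \<in> V" using \<open>V \<noteq> {}\<close> by auto
  define fib where "fib S = {x \<in> Pow E. boundary x - {r} = S}" for S
  have fin_fib: "finite (fib S)" for S
    using finE by (simp add: fib_def)
  have fib_le: "card (fib {}) \<le> card (fib S)" if S: "S \<in> Pow (V - {r})" for S
  proof -
    obtain y where y: "y \<subseteq> E" "finite y" "boundary y - {r} = S"
      using boundary_onto[OF assms r, of S] S finV by (auto intro: finite_subset)
    have "sym_diff x y \<in> fib S" if "x \<in> fib {}" for x
    proof -
      have "finite x" using that finE by (auto simp: fib_def intro: finite_subset)
      then have "boundary (sym_diff x y) - {r} = S"
        using that y by (subst boundary_symdiff) (auto simp: fib_def)
      then show ?thesis using that y by (auto simp: fib_def)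
    qed
    \<comment> \<open>Translation by \<open>y\<close> embeds the fibre over the empty set into the
      fibre over \<open>S\<close>.\<close>
    moreover have "inj_on (\<lambda>x. sym_diff x y) (fib {})"
      by (rule inj_onI) blast
    ultimately show ?thesis
      by (intro card_inj_on_le[OF _ _ fin_fib]) auto
  qed
  \<comment> \<open>The fibres are disjoint subsets of \<open>Pow E\<close>, one for each of the
    \<open>2 ^ (card V - 1)\<close> sets \<open>S\<close>.\<close>
  have "2 ^ (card V - 1) * card (fib {}) = (\<Sum>S\<in>Pow (V - {r}). card (fib {}))"
    using r finV by (simp add: card_Pow)
  also have "\<dots> \<le> (\<Sum>S\<in>Pow (V - {r}). card (fib S))"
    by (rule sum_mono) (rule fib_le)
  also have "\<dots> = card (\<Union>S\<in>Pow (V - {r}). fib S)"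
    by (rule card_UN_disjoint[symmetric]) (use finV fin_fib in \<open>auto simp: fib_def\<close>)
  also have "\<dots> \<le> card (Pow E)"
    by (rule card_mono) (use finE in \<open>auto simp: fib_def\<close>)
  finally have le: "2 ^ (card V - 1) * card (fib {}) \<le> 2 ^ card E"
    using finE by (simp add: card_Pow)
  have sub: "cycle_space E \<subseteq> fib {}"
    by (auto simp: cycle_space_def fib_def)
  \<comment> \<open>A nonempty fibre yields \<open>card V - 1 \<le> card E\<close>, so the truncated
    subtraction in the exponent is exact.\<close>
  have "{} \<in> fib {}" by (simp add: fib_def boundary_empty)
  then have "0 < card (fib {})" using fin_fib by (auto simp: card_gt_0_iff)
  then have "2 ^ (card V - 1) * 1 \<le> 2 ^ (card V - 1) * card (fib {})"
    by (intro mult_le_mono2) simp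
  with le have "(2::nat) ^ (card V - 1) \<le> 2 ^ card E" by linarith
  then have nm: "card V - 1 \<le> card E" by simp
  moreover have "0 < card V" using r finV by (auto simp: card_gt_0_iff)
  ultimately have "card E = (card V - 1) + (card E + 1 - card V)" by linarith
  then have "(2::nat) ^ card E = 2 ^ (card V - 1) * 2 ^ (card E + 1 - card V)"
    by (metis power_add)
  with le have "card (fib {}) \<le> 2 ^ (card E + 1 - card V)" by simp
  then show ?thesis
    using card_mono[OF fin_fib sub] by simp
qed

section \<open>Cycle bases span the cycle space\<close>

lemma sum_of_bool_bit:
  "finite A \<Longrightarrow> (\<Sum>x\<in>A. of_bool (P x) :: bit) = of_bool (odd (card {x \<in> A. P x}))"
proof (induction A rule: finite_induct)
  case (insert a A)
  have "{x \<in> insert a A. P x} = (if P a then insert a {x \<in> A. P x} else {x \<in> A. P x})"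
    by auto
  then show ?case using insert by auto
qed simp

text \<open>A nonempty \<open>F\<close> with vanishing sum would be a linear dependence of the cycle
  vectors with all coefficients 1.\<close>

lemma mod2_sum_independent:
  assumes es: "edge_indexing E es"
    and ind: "lin_indpt_list (card E) (map (cycle_vector es) Cs)"
    and F: "F \<subseteq> set Cs" "mod2_sum F = {}"
  shows "F = {}"
proof (rule ccontr)
  assume "F \<noteq> {}"
  then obtain D where D: "D \<in> F" by auto
  have len: "length es = card E"
    using es by (auto simp: edge_indexing_def distinct_card)
  interpret vec_space "TYPE(bit)" "card E" .
  let ?f = "cycle_vector es"
  have finF: "finite F" using F(1) finite_subset by blast
  \<comment> \<open>Distinctness of the vectors ensures that passing to the image set merges no
    summands.\<close>
  have inj: "inj_on ?f F"
    using ind F(1) by (auto simp: lin_indpt_list_def distinct_map intro: inj_on_subset)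
  have carr: "?f ` F \<subseteq> carrier_vec (card E)"
    by (auto simp: cycle_vector_def len)
  have "lincomb (\<lambda>_. 1) (?f ` F) = 0\<^sub>v (card E)"
  proof (rule eq_vecI)
    fix i assume "i < dim_vec (0\<^sub>v (card E) :: bit vec)"
    then have i: "i < card E" by simp
    then have "lincomb (\<lambda>_. 1) (?f ` F) $ i = (\<Sum>x\<in>?f ` F. 1 * x $ i)"
      using lincomb_index carr by blast
    also have "\<dots> = (\<Sum>C\<in>F. 1 * ?f C $ i)"
      by (simp only: sum.reindex[OF inj] o_def)
    also have "\<dots> = (\<Sum>C\<in>F. of_bool (es ! i \<in> C))"
      by (intro sum.cong refl) (use i in \<open>simp add: cycle_vector_def len\<close>)
    also have "\<dots> = 0"
      using F(2) unfolding sum_of_bool_bit[OF finF] by (auto simp: mod2_sum_def)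
    finally show "lincomb (\<lambda>_. 1) (?f ` F) $ i = 0\<^sub>v (card E) $ i" using i by simp
  qed (use carr finF in simp)
  then have "lin_dep (set (map ?f Cs))"
    unfolding lin_dep_def using F(1) D finF
    by (intro exI[of _ "?f ` F"] exI[of _ "\<lambda>_. 1"] exI[of _ "?f D"])
       (auto simp: module_vec_def class_ring_simps)
  then show False
    using ind by (simp add: lin_indpt_list_def)
qed

text \<open>Counting replaces a dimension argument: the subset sums of the basis are distinct
  members of the cycle space and at least as numerous as its elements, so they exhaust it.\<close>

lemma cycle_eq_mod2_sum:
  assumes conn: "connected_graph V E" and es: "edge_indexing E es"
    and basis: "cycle_basis V E es Cs" and C: "is_cycle E C"
  obtains F where "F \<subseteq> set Cs" "C = mod2_sum F"
proof -
  have finE: "finite E"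
    using conn finite_edges by (auto simp: connected_graph_def)
  have ind: "lin_indpt_list (card E) (map (cycle_vector es) Cs)"
    using basis by (simp add: cycle_basis_def)
  have cyc: "D \<in> cycle_space E" if "is_cycle E D" for D
    using that boundary_cycle by (auto simp: cycle_space_def is_cycle_def)
  have sym: "sym_diff A B \<in> cycle_space E" if "A \<in> cycle_space E" "B \<in> cycle_space E" for A B
  proof -
    have "finite A" "finite B"
      using that finE by (auto simp: cycle_space_def intro: finite_subset)
    then show ?thesis using that by (auto simp: cycle_space_def boundary_symdiff)
  qed
  have into: "mod2_sum ` Pow (set Cs) \<subseteq> cycle_space E"
  proof clarify
    fix F assume F: "F \<subseteq> set Cs"
    show "mod2_sum F \<in> cycle_space E"
    proof (rule mod2_sum_induct[where Q = "\<lambda>x. x \<in> cycle_space E"])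
      show "finite F" using F finite_subset by blast
      show "D \<in> cycle_space E" if "D \<in> F" for D
        using that F basis by (intro cyc) (auto simp: cycle_basis_def)
      show "{} \<in> cycle_space E" by (simp add: cycle_space_def boundary_empty)
    qed (rule sym)
  qed
  have "inj_on mod2_sum (Pow (set Cs))"
  proof (rule inj_onI)
    fix F G assume FG: "F \<in> Pow (set Cs)" "G \<in> Pow (set Cs)" "mod2_sum F = mod2_sum G"
    then have "finite F" "finite G" by (auto intro: finite_subset)
    \<comment> \<open>Two equal subset sums give a vanishing sum over the symmetric difference of
      the subfamilies.\<close>
    then have "mod2_sum (sym_diff F G) = {}"
      using FG by (simp add: mod2_sum_symdiff)
    then have "sym_diff F G = {}"
      using FG by (intro mod2_sum_independent[OF es ind]) auto
    then show "F = G" by auto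
  qed
  then have "card (mod2_sum ` Pow (set Cs)) = 2 ^ card (set Cs)"
    by (simp add: card_image card_Pow)
  also have "card (set Cs) = card E + 1 - card V"
    using basis distinct_card[of Cs]
    by (auto simp: cycle_basis_def lin_indpt_list_def distinct_map)
  finally have "card (cycle_space E) \<le> card (mod2_sum ` Pow (set Cs))"
    using card_cycle_space_le[OF conn] by simp
  moreover have "finite (cycle_space E)"
    using finE by (auto simp: cycle_space_def intro: finite_subset[of _ "Pow E"])
  ultimately have "mod2_sum ` Pow (set Cs) = cycle_space E"
    using into card_seteq by blast
  then show ?thesis using that cyc[OF C] by auto
qed

section \<open>Weight vectors and the balance criterion\<close>

text \<open>A coordinate contributes 1 exactly when its edge is a negative edge of \<open>C\<close>,
  and a sum of ones in GF(2) is a parity.\<close>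

lemma cycle_vector_scalar_weight_vector:
  assumes "edge_indexing E es" "C \<subseteq> E"
  shows "cycle_vector es C \<bullet> weight_vector es W = of_bool (odd (card {e \<in> C. W e = Neg}))"
proof -
  have d: "distinct es" "set es = E"
    using assms by (auto simp: edge_indexing_def)
  have "cycle_vector es C \<bullet> weight_vector es W =
      (\<Sum>i<length es. of_bool (es ! i \<in> C \<and> W (es ! i) = Neg))"
  proof -
    have "cycle_vector es C $ i * weight_vector es W $ i =
        of_bool (es ! i \<in> C \<and> W (es ! i) = Neg)" if "i < length es" for i
      using that by (cases "W (es ! i)") (auto simp: cycle_vector_def weight_vector_def)
    then show ?thesis
      by (simp only: scalar_prod_def weight_vector_def dim_vec atLeast0LessThan)
         (auto intro: sum.cong)
  qed
  also have "\<dots> = (\<Sum>e\<in>E. of_bool (e \<in> C \<and> W e = Neg))"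
    by (rule sum.reindex_bij_betw[OF bij_betw_nth[OF d(1) refl d(2)[symmetric]]])
  also have "\<dots> = of_bool (odd (card {e \<in> E. e \<in> C \<and> W e = Neg}))"
    using d by (intro sum_of_bool_bit) auto
  also have "{e \<in> E. e \<in> C \<and> W e = Neg} = {e \<in> C. W e = Neg}"
    using assms(2) by auto
  finally show ?thesis .
qed

theorem lemma2:
  fixes V :: "'a set" and E :: "'a set set" and W :: "'a set \<Rightarrow> sign"
    and es :: "'a set list" and H :: "bit mat" and n m :: nat
  assumes "connected_graph V E"
    and "card V = n" and "card E = m"
    and "edge_indexing E es"
    and "fundamental_cycle_matrix V E es H"
  shows "structurally_balanced E W \<longleftrightarrow> H *\<^sub>v weight_vector es W = 0\<^sub>v (m + 1 - n)"
proof -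
  obtain Cs where basis: "cycle_basis V E es Cs"
    and H: "H = mat_of_rows m (map (cycle_vector es) Cs)"
    using assms by (auto simp: fundamental_cycle_matrix_def)
  have finE: "finite E"
    using assms(1) finite_edges by (auto simp: connected_graph_def)
  have cyc: "\<forall>C\<in>set Cs. is_cycle E C" and lenCs: "length Cs = m + 1 - n"
    using basis assms by (auto simp: cycle_basis_def)
  have "length es = m"
    using assms by (auto simp: edge_indexing_def distinct_card)
  then have carr: "cycle_vector es C \<in> carrier_vec m" for C
    by (simp add: cycle_vector_def)
  have "H *\<^sub>v weight_vector es W = 0\<^sub>v (m + 1 - n) \<longleftrightarrow>
      (\<forall>i<length Cs. cycle_vector es (Cs ! i) \<bullet> weight_vector es W = 0)"
    using carr by (auto simp: vec_eq_iff H lenCs)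
  also have "\<dots> \<longleftrightarrow> (\<forall>C\<in>set Cs. cycle_vector es C \<bullet> weight_vector es W = 0)"
    by (simp add: all_set_conv_all_nth)
  also have "\<dots> \<longleftrightarrow> (\<forall>C\<in>set Cs. even (card {e \<in> C. W e = Neg}))"
    using cyc by (intro ball_cong refl)
      (auto simp: cycle_vector_scalar_weight_vector[OF assms(4)] is_cycle_def)
  also have "\<dots> \<longleftrightarrow> structurally_balanced E W"
  proof
    assume "structurally_balanced E W"
    then show "\<forall>C\<in>set Cs. even (card {e \<in> C. W e = Neg})"
      using cyc by (simp add: structurally_balanced_def)
  next
    assume ev: "\<forall>C\<in>set Cs. even (card {e \<in> C. W e = Neg})"
    show "structurally_balanced E W"
      unfolding structurally_balanced_def
    proof (intro allI impI)
      fix C assume "is_cycle E C"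
      then obtain F where F: "F \<subseteq> set Cs" "C = mod2_sum F"
        using cycle_eq_mod2_sum[OF assms(1,4) basis] by blast
      have finC: "finite D" if "D \<in> F" for D
        using that F cyc finE finite_subset[of D E] by (auto simp: is_cycle_def)
      \<comment> \<open>Finiteness is carried through the induction because additivity of the parity
        requires finite sets.\<close>
      have "finite (mod2_sum F) \<and> even (card {e \<in> mod2_sum F. W e = Neg})"
      proof (rule mod2_sum_induct)
        show "finite F" using F finite_subset by blast
        show "finite D \<and> even (card {e \<in> D. W e = Neg})" if "D \<in> F" for D
          using that F ev finC by blast
        show "finite (sym_diff A B) \<and> even (card {e \<in> sym_diff A B. W e = Neg})"
          if "finite A \<and> even (card {e \<in> A. W e = Neg})"
            "finite B \<and> even (card {e \<in> B. W e = Neg})" for A B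
          using that odd_card_symdiff[of A B "\<lambda>e. W e = Neg"] by blast
      qed simp
      then show "even (card {e \<in> C. W e = Neg})" using F by simp
    qed
  qed
  finally show ?thesis by simp
qed

end
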